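(* There are TRSs that are polynomially terminating over both $\mathbb{N}$ and $\mathbb{R}$, but are not polynomially terminating over $\mathbb{Q}$.
   Context: A polynomial interpretation over $\mathbb{N}$ for a signature $\mathcal{F}$ assigns to each $n$-ary $f$ a polynomial $f_\mathbb{N} \in \mathbb{Z}[x_1,\dots,x_n]$ such that $f_\mathbb{N}(\mathbb{N}^n) \subseteq \mathbb{N}$ and $f_\mathbb{N}$ is strictly monotone in every argument with respect to the standard order $>$ on $\mathbb{N}$; it is compatible with a TRS $\mathcal{R}$ if $[\alpha](\ell) > [\alpha](r)$ for every rule $\ell \to r$ and every assignment $\alpha$ of variables into $\mathbb{N}$; $\mathcal{R}$ is polynomially terminating over $\mathbb{N}$ if such a compatible interpretation exists. For $D \in \{\mathbb{Q},\mathbb{R}\}$, with $D_0 = \{x\in D : x\ge 0\}$: a polynomial interpretation over $D$ consists of $\delta \in D$, $\delta>0$, and polynomials $f_D \in D[x_1,\dots,x_n]$ with $f_D(D_0^n) \subseteq D_0$; define $x >_{D_0,\delta} y$ iff $x - y \ge \delta$; it is strictly monotone if every $f_D$ is monotone in each argument w.r.t. $>_{D_0,\delta}$ on $D_0$, and compatible with $\mathcal{R}$ if $[\alpha](\ell) >_{D_0,\delta} [\alpha](r)$ for all rules and all assignments into $D_0$; $\mathcal{R}$ is polynomially terminating over $D$ if there is a strictly monotone compatible polynomial interpretation over $D$. *)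

theory Defs
  imports Complex_Main "HOL-Library.Poly_Mapping"
begin

datatype ('f, 'v) trm = Var 'v | Fun 'f "('f, 'v) trm list"

primrec vars_trm :: "('f, 'v) trm \<Rightarrow> 'v set" where
  "vars_trm (Var x) = {x}"
| "vars_trm (Fun f ts) = \<Union> (set (map vars_trm ts))"

type_synonym 'f signature = "'f \<rightharpoonup> nat"  \<comment> \<open>a fixed-arity signature: its symbols, with their arities\<close>

primrec wf_trm :: "'f signature \<Rightarrow> ('f, 'v) trm \<Rightarrow> bool" where
  "wf_trm F (Var x) = True"
| "wf_trm F (Fun f ts) = (F f = Some (length ts) \<and> list_all (\<lambda>b. b) (map (wf_trm F) ts))"

type_synonym ('f, 'v) rule = "('f, 'v) trm \<times> ('f, 'v) trm"

definition rewrite_rule :: "'f signature \<Rightarrow> ('f, 'v) rule \<Rightarrow> bool" where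
  "rewrite_rule F lr \<longleftrightarrow>
     wf_trm F (fst lr) \<and> wf_trm F (snd lr) \<and>
     (\<forall>x. fst lr \<noteq> Var x) \<and> vars_trm (snd lr) \<subseteq> vars_trm (fst lr)"

definition trs :: "'f signature \<Rightarrow> ('f, 'v) rule set \<Rightarrow> bool" where
  "trs F R \<longleftrightarrow> finite (dom F) \<and> finite R \<and> (\<forall>lr\<in>R. rewrite_rule F lr)"

text \<open>
  A multivariate polynomial is a finitely supported map from monomials to coefficients, a
  monomial being a finitely supported map from variable indices to exponents. The indices are
  \<open>0, 1, 2, \<dots>\<close>; \<open>polys n\<close> are the polynomials in the first \<open>n\<close> indeterminates.
\<close>

type_synonym 'a mpoly = "(nat \<Rightarrow>\<^sub>0 nat) \<Rightarrow>\<^sub>0 'a"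

definition polys :: "nat \<Rightarrow> 'a::zero mpoly set" where
  "polys n = {p. \<forall>m \<in> Poly_Mapping.keys p. Poly_Mapping.keys m \<subseteq> {..<n}}"

text \<open>
  For \<open>p \<in> polys (length xs)\<close> only entries \<open>xs ! i\<close> with \<open>i < length xs\<close> are used.
\<close>

definition mpoly_eval :: "'a::comm_semiring_1 mpoly \<Rightarrow> 'a list \<Rightarrow> 'a" where
  "mpoly_eval p xs =
     (\<Sum>m \<in> Poly_Mapping.keys p. Poly_Mapping.lookup p m *
        (\<Prod>i \<in> Poly_Mapping.keys m. (xs ! i) ^ Poly_Mapping.lookup m i))"

primrec trm_eval :: "('f \<Rightarrow> 'a::comm_semiring_1 mpoly) \<Rightarrow> ('v \<Rightarrow> 'a) \<Rightarrow> ('f, 'v) trm \<Rightarrow> 'a" where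
  "trm_eval I \<alpha> (Var x) = \<alpha> x"
| "trm_eval I \<alpha> (Fun f ts) = mpoly_eval (I f) (map (trm_eval I \<alpha>) ts)"

text \<open>
  In the following, \<open>A\<close> is the carrier of the interpretation, a subset of the coefficient ring.
\<close>

definition poly_interp ::
    "'f signature \<Rightarrow> 'a::comm_semiring_1 set \<Rightarrow> ('f \<Rightarrow> 'a mpoly) \<Rightarrow> bool" where
  "poly_interp F A I \<longleftrightarrow>
     (\<forall>f n. F f = Some n \<longrightarrow>
        I f \<in> polys n \<and>
        (\<forall>xs. length xs = n \<and> set xs \<subseteq> A \<longrightarrow> mpoly_eval (I f) xs \<in> A))"

definition monotone_interp ::
    "'f signature \<Rightarrow> 'a::comm_semiring_1 set \<Rightarrow> ('a \<Rightarrow> 'a \<Rightarrow> bool) \<Rightarrow> ('f \<Rightarrow> 'a mpoly) \<Rightarrow> bool" where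
  "monotone_interp F A gt I \<longleftrightarrow>
     (\<forall>f n. F f = Some n \<longrightarrow>
        (\<forall>xs i y. length xs = n \<and> set xs \<subseteq> A \<and> i < n \<and> y \<in> A \<and> gt (xs ! i) y \<longrightarrow>
           gt (mpoly_eval (I f) xs) (mpoly_eval (I f) (xs[i := y]))))"

definition compatible_interp ::
    "('f, 'v) rule set \<Rightarrow> 'a::comm_semiring_1 set \<Rightarrow> ('a \<Rightarrow> 'a \<Rightarrow> bool) \<Rightarrow> ('f \<Rightarrow> 'a mpoly) \<Rightarrow> bool" where
  "compatible_interp R A gt I \<longleftrightarrow>
     (\<forall>(l, r) \<in> R. \<forall>\<alpha>. range \<alpha> \<subseteq> A \<longrightarrow> gt (trm_eval I \<alpha> l) (trm_eval I \<alpha> r))"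

text \<open>The natural numbers appear as the subset \<open>\<nat>\<close> of the coefficient ring \<open>int\<close>.\<close>

definition poly_terminating_nat :: "'f signature \<Rightarrow> ('f, 'v) rule set \<Rightarrow> bool" where
  "poly_terminating_nat F R \<longleftrightarrow>
     (\<exists>I :: 'f \<Rightarrow> int mpoly.
        poly_interp F \<nat> I \<and> monotone_interp F \<nat> (>) I \<and> compatible_interp R \<nat> (>) I)"

definition gt_delta :: "'a::linordered_field \<Rightarrow> 'a \<Rightarrow> 'a \<Rightarrow> bool" where
  "gt_delta \<delta> x y \<longleftrightarrow> x - y \<ge> \<delta>"

text \<open>The type argument is the field \<open>D\<close>, so \<open>{0..}\<close> is \<open>D\<^sub>0\<close>.\<close>

definition poly_terminating_field ::
    "'a::linordered_field itself \<Rightarrow> 'f signature \<Rightarrow> ('f, 'v) rule set \<Rightarrow> bool" where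
  "poly_terminating_field D F R \<longleftrightarrow>
     (\<exists>(\<delta> :: 'a) (I :: 'f \<Rightarrow> 'a mpoly). \<delta> > 0 \<and>
        poly_interp F {0..} I \<and> monotone_interp F {0..} (gt_delta \<delta>) I \<and>
        compatible_interp R {0..} (gt_delta \<delta>) I)"

end

theory Submission
  imports Defs "HOL-Computational_Algebra.Polynomial"
begin

text \<open>
  The rules force, up to additive constants, the interpretations \<open>s(x) = x + s\<^sub>0\<close>, \<open>h(x, y) = x + y\<close>
  and \<open>g(x) = u x\<close>, where \<open>u\<^sup>3 + 300 = 30 u\<^sup>2 + 10 u\<close>, that is \<open>(u - 30) (u\<^sup>2 - 10) = 0\<close>, and they force
  \<open>f(x + s\<^sub>0) - f(x) - u x\<close> to be constant, so that \<open>f\<close> is quadratic. Moreover \<open>f\<close> has small values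
  at \<open>z\<close> and \<open>z + s\<^sub>0\<close>, where \<open>z\<close> interprets the constant.
  Over the naturals \<open>u = 30\<close> with \<open>f(x) = 15 x\<^sup>2 - 14 x\<close> works, over the reals \<open>u = sqrt 10\<close> with
  \<open>f(x) = (u / 2) x\<^sup>2\<close>. Over the rationals \<open>u = 30\<close> is the only root, and the steep parabola \<open>f\<close> is
  then negative at the midpoint \<open>z + s\<^sub>0 / 2\<close>.
\<close>

section \<open>Polynomials on the nonnegative half-line\<close>

text \<open>Induction on the Horner form c + x q(x): a nonconstant q is eventually at least 1, so x
  q(x) is eventually at least x. The argument uses only the field order, so it covers the rationals
  as well as the reals.\<close>

lemma poly_eventually_ge:
  fixes p :: "'a::linordered_field poly"
  assumes "degree p > 0" "lead_coeff p > 0"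
  shows "\<exists>n. \<forall>x\<ge>n. poly p x \<ge> C"
  using assms
proof (induction p arbitrary: C)
  case 0
  then show ?case by simp
next
  case (pCons c q)
  show ?case
  proof (cases "degree q = 0")
    case True
    then obtain d where q: "q = [:d:]" by (metis degree_eq_zeroE)
    have d: "d > 0" using pCons.prems q by (auto split: if_splits)
    have "poly (pCons c q) x \<ge> C" if "x \<ge> (C - c) / d" for x
      using that d q by (simp add: field_simps)
    then show ?thesis by blast
  next
    case False
    then have "lead_coeff q > 0" using pCons.prems by (auto split: if_splits)
    with False pCons.IH[of 1] obtain n where n: "\<forall>x\<ge>n. poly q x \<ge> 1" by auto
    have "poly (pCons c q) x \<ge> C" if "x \<ge> max n (max 0 (C - c))" for x
    proof -
      have "x * 1 \<le> x * poly q x" using that n by (intro mult_left_mono) auto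
      then show ?thesis using that by simp
    qed
    then show ?thesis by blast
  qed
qed

lemma lead_coeff_nonneg:
  fixes p :: "'a::linordered_field poly"
  assumes "\<And>x. x \<ge> 0 \<Longrightarrow> poly p x \<ge> 0"
  shows "lead_coeff p \<ge> 0"
proof (rule ccontr)
  assume neg: "\<not> lead_coeff p \<ge> 0"
  show False
  proof (cases "degree p = 0")
    case True
    then obtain d where "p = [:d:]" by (metis degree_eq_zeroE)
    then show False using neg assms[of 0] by simp
  next
    case False
    then obtain n where n: "\<forall>x\<ge>n. poly (- p) x \<ge> 1"
      using poly_eventually_ge[of "- p" 1] neg by auto
    have "poly p (max 0 n) \<le> -1" using n[rule_format, of "max 0 n"] by simp
    moreover have "poly p (max 0 n) \<ge> 0" by (intro assms) simp
    ultimately show False by linarith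
  qed
qed

text \<open>At a common degree bound n, the coefficient of p - q is either its leading coefficient,
  hence nonnegative, or zero.\<close>

lemma coeff_mono_of_poly_le:
  fixes p q :: "'a::linordered_field poly"
  assumes "\<And>x. x \<ge> 0 \<Longrightarrow> poly q x \<le> poly p x" "degree p \<le> n" "degree q \<le> n"
  shows "coeff q n \<le> coeff p n"
proof -
  have l: "lead_coeff (p - q) \<ge> 0" using assms(1) by (intro lead_coeff_nonneg) simp
  have "degree (p - q) \<le> n" using assms by (simp add: degree_diff_le)
  then consider "degree (p - q) = n" | "degree (p - q) < n" by linarith
  then have "coeff (p - q) n \<ge> 0"
    using l by cases (auto simp: coeff_eq_0 simp del: coeff_diff)
  then show ?thesis by simp
qed

text \<open>If q had the larger degree, p would have coefficient 0 there, so the leading coefficient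
  of q would be both nonpositive and nonnegative, forcing q = 0.\<close>

lemma degree_mono_of_poly_le:
  fixes p q :: "'a::linordered_field poly"
  assumes "\<And>x. x \<ge> 0 \<Longrightarrow> 0 \<le> poly q x" "\<And>x. x \<ge> 0 \<Longrightarrow> poly q x \<le> poly p x"
  shows "degree q \<le> degree p"
proof (rule ccontr)
  assume n: "\<not> degree q \<le> degree p"
  then have "lead_coeff q \<le> coeff p (degree q)"
    using assms(2) by (intro coeff_mono_of_poly_le) auto
  then have "lead_coeff q \<le> 0" using n by (simp add: coeff_eq_0)
  moreover have "lead_coeff q \<ge> 0" using assms(1) by (intro lead_coeff_nonneg) simp
  ultimately show False using n by auto
qed

lemma slope_le_of_affine_le:
  fixes a b c d :: "'a::linordered_field"
  assumes "\<And>x. x \<ge> 0 \<Longrightarrow> a * x + b \<le> c * x + d"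
  shows "a \<le> c"
proof -
  have "coeff [:b, a:] 1 \<le> coeff [:d, c:] 1"
    using assms by (intro coeff_mono_of_poly_le) (auto simp: algebra_simps)
  then show ?thesis by simp
qed

lemma bounded_poly_constant:
  fixes p :: "'a::linordered_field poly"
  assumes "\<And>x. x \<ge> 0 \<Longrightarrow> l \<le> poly p x" "\<And>x. x \<ge> 0 \<Longrightarrow> poly p x \<le> m"
  obtains c where "p = [:c:]"
proof -
  have "degree (p - [:l:]) \<le> degree [:m - l:]"
    using assms by (intro degree_mono_of_poly_le) auto
  then have "degree (p - [:l:] + [:l:]) \<le> 0"
    by (intro degree_add_le) auto
  then show ?thesis using that by (metis degree_eq_zeroE diff_add_cancel le_zero_eq)
qed

text \<open>p - p(0) vanishes at every multiple n c, which gives infinitely many roots.\<close>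

lemma periodic_poly_constant:
  fixes p :: "'a::linordered_field poly"
  assumes "\<And>x. x \<ge> 0 \<Longrightarrow> poly p (x + c) = poly p x" "c > 0"
  shows "poly p x = poly p 0"
proof -
  have grid: "poly p (of_nat n * c) = poly p 0" for n
  proof (induction n)
    case (Suc n)
    have "of_nat (Suc n) * c = of_nat n * c + c" by (simp add: algebra_simps)
    then show ?case using Suc assms by simp
  qed simp
  have "inj (\<lambda>n. of_nat n * c)" using assms(2) by (auto simp: inj_on_def)
  then have "infinite (range (\<lambda>n. of_nat n * c))" by (simp add: finite_image_iff)
  moreover have "range (\<lambda>n. of_nat n * c) \<subseteq> {x. poly (p - [:poly p 0:]) x = 0}"
    using grid by auto
  ultimately have "infinite {x. poly (p - [:poly p 0:]) x = 0}" by (metis finite_subset)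
  then have "p - [:poly p 0:] = 0" using poly_roots_finite by blast
  then show ?thesis by (metis add.right_neutral eq_iff_diff_eq_0 mult_zero_right poly_0 poly_pCons)
qed

section \<open>Monotonicity with gap \<delta> in one variable\<close>

definition delta_mono :: "'a::linordered_field \<Rightarrow> ('a \<Rightarrow> 'a) \<Rightarrow> bool" where
  "delta_mono \<delta> \<phi> \<longleftrightarrow> (\<forall>x y. 0 \<le> y \<and> y + \<delta> \<le> x \<longrightarrow> \<phi> y + \<delta> \<le> \<phi> x)"

lemma delta_mono_degree_pos:
  assumes "delta_mono \<delta> (poly p)" "\<delta> > 0"
  shows "degree p > 0"
proof (rule ccontr)
  assume "\<not> degree p > 0"
  then obtain d where "p = [:d:]" by (metis degree_eq_zeroE neq0_conv)
  then show False using assms unfolding delta_mono_def by force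
qed

lemma delta_mono_slope_ge_1:
  assumes "delta_mono \<delta> (\<lambda>x. a * x + b)" "\<delta> > 0"
  shows "a \<ge> 1"
proof -
  have "a * 0 + b + \<delta> \<le> a * \<delta> + b"
    using assms unfolding delta_mono_def by (metis add_0 order_refl)
  then show ?thesis using assms by simp
qed

lemma degree_le_1_eval:
  assumes "degree p \<le> 1"
  shows "poly p x = coeff p 1 * x + coeff p 0"
proof -
  obtain a q where p: "p = pCons a q" by (cases p) auto
  with assms have "degree q = 0" by (auto split: if_splits)
  then obtain b where "q = [:b:]" by (metis degree_eq_zeroE)
  then show ?thesis using p by (simp add: algebra_simps)
qed

text \<open>A parity argument on a fraction in lowest terms. It discards the factor u^2 - 10 of the
  cubic that the rules impose on the slope u of g.\<close>

lemma rat_square_neq_10: "(u::rat) ^ 2 \<noteq> 10"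
proof
  assume h: "u ^ 2 = 10"
  obtain a b where ab: "quotient_of u = (a, b)" by force
  have b: "b > 0" and co: "coprime a b" and u: "u = of_int a / of_int b"
    using ab quotient_of_denom_pos quotient_of_coprime quotient_of_div by auto
  have "(of_int (a ^ 2) :: rat) = of_int (10 * b ^ 2)"
    using h b u by (simp add: field_simps power2_eq_square)
  then have e: "a ^ 2 = 10 * b ^ 2" by (simp only: of_int_eq_iff)
  then have "even (a ^ 2)" by simp
  then have ea: "even a" by simp
  then obtain c where "a = 2 * c" by blast
  with e have "2 * c ^ 2 = 5 * b ^ 2" by (simp add: power2_eq_square)
  then have "even (5 * b ^ 2)" by (metis dvd_triv_left)
  then have "even b" by simp
  with ea co show False by (metis coprime_common_divisor odd_one)
qed

section \<open>Evaluation of multivariate polynomials\<close>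

lemma mpoly_eval_superset:
  assumes "finite A" "Poly_Mapping.keys p \<subseteq> A"
  shows "mpoly_eval p xs = (\<Sum>m\<in>A. Poly_Mapping.lookup p m *
     (\<Prod>i \<in> Poly_Mapping.keys m. (xs ! i) ^ Poly_Mapping.lookup m i))"
  unfolding mpoly_eval_def
  using assms by (intro sum.mono_neutral_left) (auto simp: in_keys_iff)

lemma mpoly_eval_add: "mpoly_eval (p + q) xs = mpoly_eval p xs + mpoly_eval q xs"
proof -
  let ?A = "Poly_Mapping.keys p \<union> Poly_Mapping.keys q"
  have "Poly_Mapping.keys (p + q) \<subseteq> ?A" by (rule Poly_Mapping.keys_add)
  then show ?thesis
    by (simp add: mpoly_eval_superset[of ?A] lookup_add distrib_right sum.distrib)
qed

lemma mpoly_eval_single: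
  "mpoly_eval (Poly_Mapping.single m c) xs =
     c * (\<Prod>i \<in> Poly_Mapping.keys m. (xs ! i) ^ Poly_Mapping.lookup m i)"
  by (simp add: mpoly_eval_superset[of "{m}"])

text \<open>Freezing all arguments but one leaves an ordinary polynomial, so the univariate degree
  comparisons apply to interpretations. The witness replaces indeterminate i by
  \<open>[:0, 1:]\<close> and every other one by a constant.\<close>

lemma mpoly_eval_section_poly:
  fixes p :: "'a::comm_ring_1 mpoly"
  assumes "i < length xs"
  obtains P where "\<And>x. mpoly_eval p (xs[i := x]) = poly P x"
proof
  fix x
  show "mpoly_eval p (xs[i := x]) = poly (\<Sum>m \<in> Poly_Mapping.keys p. [:Poly_Mapping.lookup p m:] *
      (\<Prod>j \<in> Poly_Mapping.keys m. (if j = i then [:0, 1:] else [:xs ! j:]) ^ Poly_Mapping.lookup m j)) x"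
    unfolding mpoly_eval_def poly_sum poly_mult poly_prod poly_power
    using assms by (intro sum.cong refl arg_cong2[of _ _ _ _ "(*)"] prod.cong) auto
qed

section \<open>The rewrite system\<close>

abbreviation "zeroT \<equiv> Fun (0::nat) []"
abbreviation "succT t \<equiv> Fun (1::nat) [t]"
abbreviation "fT t \<equiv> Fun (2::nat) [t]"
abbreviation "gT t \<equiv> Fun (3::nat) [t]"
abbreviation "plusT t u \<equiv> Fun (4::nat) [t, u]"
abbreviation "timesT n t \<equiv> (plusT t ^^ n) zeroT"
abbreviation "xT \<equiv> Var (0::nat)"

definition sig :: "nat signature" where
  "sig = [0 \<mapsto> 0, 1 \<mapsto> 1, 2 \<mapsto> 1, 3 \<mapsto> 1, 4 \<mapsto> 2]"

text \<open>In order: the first two rules duplicate g and s on the right, which makes g affine and s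
  a shift; the next three bound h on the diagonal and along the constant, which makes it a sum; then
  f(s(x)) is squeezed around f(x) + g(x), and f is bounded at z and s(z). The last two compare g^3 +
  300 with 30 g^2 + 10 g in both directions, so their slopes must agree. The powers 4, 3 and 500 of
  s only add slack, enough for both intended interpretations.\<close>

definition rules :: "(nat, nat) rule set" where
  "rules = {
     (fT (gT xT), gT (gT (fT xT))),
     (gT (succT xT), succT (succT (gT xT))),
     (gT xT, plusT xT xT),
     (succT xT, plusT xT zeroT),
     (succT xT, plusT zeroT xT),
     (plusT (fT xT) (gT xT), fT (succT xT)),
     ((succT ^^ 4) (fT (succT xT)), plusT (fT xT) (gT xT)),
     (succT zeroT, fT zeroT),
     ((succT ^^ 3) zeroT, fT (succT zeroT)),
     ((succT ^^ 500) (plusT (gT (gT (gT xT))) (timesT 300 xT)),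
        plusT (timesT 30 (gT (gT xT))) (timesT 10 (gT xT))),
     (plusT (timesT 30 (gT (gT xT))) (timesT 10 (gT xT)),
        plusT (gT (gT (gT xT))) (timesT 300 xT))}"

section \<open>Well-formedness, variables and values of iterated contexts\<close>

lemma wf_trm_funpow:
  fixes C :: "('f, 'v) trm \<Rightarrow> ('f, 'v) trm"
  assumes "wf_trm F t" "\<And>u. wf_trm F u \<Longrightarrow> wf_trm F (C u)"
  shows "wf_trm F ((C ^^ n) t)"
  by (induction n) (simp_all add: assms)

lemma vars_trm_funpow_succT: "vars_trm ((succT ^^ n) t) = vars_trm t"
  by (induction n) auto

lemma vars_trm_timesT: "vars_trm (timesT n t) = (if n = 0 then {} else vars_trm t)"
  by (induction n) auto

lemma funpow_succT_neq_Var: "n > 0 \<Longrightarrow> (succT ^^ n) t \<noteq> Var x"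
  by (cases n) auto

lemma trs_rules: "trs sig rules"
proof -
  have "rewrite_rule sig lr" if "lr \<in> rules" for lr
    using that unfolding rules_def
    by (auto simp: rewrite_rule_def sig_def vars_trm_funpow_succT vars_trm_timesT
        funpow_succT_neq_Var simp del: One_nat_def
        intro!: wf_trm_funpow)
  then show ?thesis by (auto simp: trs_def sig_def rules_def)
qed

lemma trm_eval_funpow_succT:
  "trm_eval I \<alpha> ((succT ^^ n) t) = ((\<lambda>x. mpoly_eval (I 1) [x]) ^^ n) (trm_eval I \<alpha> t)"
  by (induction n) auto

lemma trm_eval_timesT:
  "trm_eval I \<alpha> (timesT n t) =
     ((\<lambda>y. mpoly_eval (I 4) [trm_eval I \<alpha> t, y]) ^^ n) (mpoly_eval (I 0) [])"
  by (induction n) auto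

lemma funpow_shift: "((\<lambda>x. x + c) ^^ n) (x::'a::comm_ring_1) = x + of_nat n * c"
  by (induction n) (auto simp: algebra_simps)

lemma funpow_plus_left: "((\<lambda>y. v + y) ^^ n) (x::'a::comm_ring_1) = of_nat n * v + x"
  by (induction n) (auto simp: algebra_simps)

section \<open>Interpretations over the naturals and the reals\<close>

abbreviation var_pow :: "nat \<Rightarrow> nat \<Rightarrow> 'a::zero \<Rightarrow> 'a mpoly" where
  "var_pow i e c \<equiv> Poly_Mapping.single (Poly_Mapping.single i e) c"

text \<open>One family for both positive results: (a, b, u) is (15, -14, 30) over the naturals and
  (u/2, 0, u) with u = sqrt 10 over the reals. A summand \<open>var_pow 0 0 c\<close> is the
  constant c, its monomial being empty.\<close>

definition interp :: "'a::comm_ring_1 \<Rightarrow> 'a \<Rightarrow> 'a \<Rightarrow> nat \<Rightarrow> 'a mpoly" where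
  "interp a b u = (\<lambda>_. 0)(
     1 := var_pow 0 1 1 + var_pow 0 0 1,
     2 := var_pow 0 2 a + var_pow 0 1 b,
     3 := var_pow 0 1 u + var_pow 0 0 4,
     4 := var_pow 0 1 1 + var_pow 1 1 1)"

lemma mpoly_eval_var_pow: "mpoly_eval (var_pow i e c) xs = c * (xs ! i) ^ e"
  by (cases "e = 0") (simp_all add: mpoly_eval_single)

lemma var_pow_polys: "e = 0 \<or> i < n \<Longrightarrow> var_pow i e c \<in> polys n"
  by (auto simp: polys_def split: if_splits)

lemma add_polys: "p \<in> polys n \<Longrightarrow> q \<in> polys n \<Longrightarrow> p + q \<in> polys n"
  unfolding polys_def using Poly_Mapping.keys_add[of p q] by blast

lemma interp_eval:
  "mpoly_eval (interp a b u 0) xs = 0"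
  "mpoly_eval (interp a b u 1) [x] = x + 1"
  "mpoly_eval (interp a b u (Suc 0)) [x] = x + 1"
  "mpoly_eval (interp a b u 2) [x] = a * x ^ 2 + b * x"
  "mpoly_eval (interp a b u 3) [x] = u * x + 4"
  "mpoly_eval (interp a b u 4) [x, y] = x + y"
  by (simp_all add: interp_def mpoly_eval_add mpoly_eval_var_pow
      del: single_numeral single_one single_zero)
    (simp add: mpoly_eval_def)

lemma interp_polys: "sig f = Some n \<Longrightarrow> interp a b u f \<in> polys n"
  by (auto simp: sig_def interp_def simp del: single_numeral single_one single_zero
      split: if_splits intro!: add_polys var_pow_polys) (simp add: polys_def)

section \<open>Criteria for the family \<open>interp\<close> over an arbitrary carrier\<close>

lemma sig_cases:
  assumes "sig f = Some n" "length xs = n"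
  obtains "f = 0" "n = 0" "xs = []"
  | x where "f = 1" "n = 1" "xs = [x]"
  | x where "f = 2" "n = 1" "xs = [x]"
  | x where "f = 3" "n = 1" "xs = [x]"
  | x y where "f = 4" "n = 2" "xs = [x, y]"
  using assms by (auto simp: sig_def length_Suc_conv numeral_2_eq_2 eq_commute[of _ "length xs"] split: if_splits)

lemma poly_interp_interp:
  assumes "0 \<in> A" "\<And>x. x \<in> A \<Longrightarrow> x + 1 \<in> A" "\<And>x. x \<in> A \<Longrightarrow> a * x ^ 2 + b * x \<in> A"
    "\<And>x. x \<in> A \<Longrightarrow> u * x + 4 \<in> A" "\<And>x y. x \<in> A \<Longrightarrow> y \<in> A \<Longrightarrow> x + y \<in> A"
  shows "poly_interp sig A (interp a b u)"
  unfolding poly_interp_def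
proof (intro allI impI conjI; (elim conjE)?)
  fix f n xs
  assume "sig f = Some n" "length xs = n" "set xs \<subseteq> A"
  then show "mpoly_eval (interp a b u f) xs \<in> A"
    using assms by (elim sig_cases) (auto simp: interp_eval)
qed (rule interp_polys)

lemma monotone_interp_interp:
  assumes "\<And>x y. x \<in> A \<Longrightarrow> y \<in> A \<Longrightarrow> gt x y \<Longrightarrow> gt (x + 1) (y + 1)"
    "\<And>x y. x \<in> A \<Longrightarrow> y \<in> A \<Longrightarrow> gt x y \<Longrightarrow> gt (a * x ^ 2 + b * x) (a * y ^ 2 + b * y)"
    "\<And>x y. x \<in> A \<Longrightarrow> y \<in> A \<Longrightarrow> gt x y \<Longrightarrow> gt (u * x + 4) (u * y + 4)"
    "\<And>x y v. x \<in> A \<Longrightarrow> y \<in> A \<Longrightarrow> v \<in> A \<Longrightarrow> gt x y \<Longrightarrow> gt (x + v) (y + v)"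
    "\<And>x y v. x \<in> A \<Longrightarrow> y \<in> A \<Longrightarrow> v \<in> A \<Longrightarrow> gt x y \<Longrightarrow> gt (v + x) (v + y)"
  shows "monotone_interp sig A gt (interp a b u)"
  unfolding monotone_interp_def
proof (intro allI impI; elim conjE)
  fix f n xs i y
  assume "sig f = Some n" "length xs = n" "set xs \<subseteq> A" "i < n" "y \<in> A" "gt (xs ! i) y"
  then show "gt (mpoly_eval (interp a b u f) xs) (mpoly_eval (interp a b u f) (xs[i := y]))"
    using assms by (elim sig_cases) (auto simp: interp_eval less_2_cases_iff)
qed

text \<open>The conjuncts are the eleven rules in order. Summands such as \<open>x + 0\<close> and
  \<open>of_nat 4 * 1\<close> are left unsimplified so that they agree literally with the evaluated
  terms.\<close>

lemma compatible_interp_interp: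
  assumes "\<And>x. x \<in> A \<Longrightarrow>
      gt (a * (u * x + 4) ^ 2 + b * (u * x + 4)) (u * (u * (a * x ^ 2 + b * x) + 4) + 4) \<and>
      gt (u * (x + 1) + 4) (u * x + 4 + 1 + 1) \<and>
      gt (u * x + 4) (x + x) \<and>
      gt (x + 1) (x + 0) \<and>
      gt (x + 1) (0 + x) \<and>
      gt (a * x ^ 2 + b * x + (u * x + 4)) (a * (x + 1) ^ 2 + b * (x + 1)) \<and>
      gt (a * (x + 1) ^ 2 + b * (x + 1) + of_nat 4 * 1) (a * x ^ 2 + b * x + (u * x + 4)) \<and>
      gt (0 + 1) (a * 0 ^ 2 + b * 0) \<and>
      gt (0 + of_nat 3 * 1) (a * (0 + 1) ^ 2 + b * (0 + 1)) \<and>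
      gt (u * (u * (u * x + 4) + 4) + 4 + (of_nat 300 * x + 0) + of_nat 500 * 1)
         (of_nat 30 * (u * (u * x + 4) + 4) + 0 + (of_nat 10 * (u * x + 4) + 0)) \<and>
      gt (of_nat 30 * (u * (u * x + 4) + 4) + 0 + (of_nat 10 * (u * x + 4) + 0))
         (u * (u * (u * x + 4) + 4) + 4 + (of_nat 300 * x + 0))"
  shows "compatible_interp rules A gt (interp a b u)"
proof -
  have "gt (trm_eval (interp a b u) \<alpha> l) (trm_eval (interp a b u) \<alpha> r)"
    if "(l, r) \<in> rules" "range \<alpha> \<subseteq> A" for l r and \<alpha> :: "nat \<Rightarrow> 'a"
  proof -
    \<comment> \<open>\<open>xT\<close> is the only variable in the rules, so its value determines
      both sides.\<close>
    have "\<alpha> 0 \<in> A" using that by auto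
    from assms[OF this] that(1) show ?thesis
      unfolding rules_def insert_iff empty_iff prod.inject
      by (elim disjE conjE FalseE; hypsubst;
          simp only: trm_eval.simps list.map trm_eval_funpow_succT trm_eval_timesT interp_eval
            funpow_shift funpow_plus_left)
  qed
  then show ?thesis unfolding compatible_interp_def by blast
qed

text \<open>15 x^2 - 14 x is negative strictly between 0 and 14/15, but no natural number lies
  there. Its values 0 and 1 at the points 0 and 1 are small enough for the two rules that bound f at
  z and s(z).\<close>

lemma poly_terminating_nat_rules: "poly_terminating_nat sig rules"
proof -
  let ?I = "interp 15 (-14) 30 :: nat \<Rightarrow> int mpoly"
  have f: "15 * x ^ 2 + - 14 * x = x * (15 * x - 14)" for x :: int
    by (simp add: power2_eq_square algebra_simps)
  have "0 \<le> x * (15 * x - 14)" if "x \<ge> 0" for x :: int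
    using that by (cases "x = 0") auto
  then have "poly_interp sig \<nat> ?I"
    unfolding Nats_altdef2 by (intro poly_interp_interp) (simp_all only: f mem_Collect_eq, simp_all)
  moreover have "y * (15 * y - 14) < x * (15 * x - 14)" if "0 \<le> y" "y < x" for x y :: int
  proof -
    \<comment> \<open>The product is the difference of the two values of f; its second factor is
      positive because x + y is at least 1.\<close>
    have "0 < (x - y) * (15 * (x + y) - 14)" using that by (intro mult_pos_pos) auto
    then show ?thesis by (simp add: algebra_simps)
  qed
  then have "monotone_interp sig \<nat> (>) ?I"
    unfolding Nats_altdef2 by (intro monotone_interp_interp; unfold f mem_Collect_eq) auto
  moreover have "compatible_interp rules \<nat> (>) ?I"
    by (intro compatible_interp_interp)
      (auto simp: Nats_altdef2 power2_eq_square algebra_simps)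
  ultimately show ?thesis unfolding poly_terminating_nat_def by blast
qed

lemma poly_terminating_real_rules: "poly_terminating_field TYPE(real) sig rules"
proof -
  define u where "u = sqrt 10"
  \<comment> \<open>The upper bound 13/4 matters most in the rule with slack 500: the x terms cancel
    and 384 - 116 u must be at least \<delta> = 1.\<close>
  have u2: "u * u = 10" and "3 \<le> u" "u \<le> 13 / 4"
    unfolding u_def by (simp, rule real_le_rsqrt, simp, rule real_le_lsqrt, simp_all add: power2_eq_square)
  let ?I = "interp (u / 2) 0 u"
  have "poly_interp sig {0..} ?I"
    using \<open>3 \<le> u\<close> by (intro poly_interp_interp) auto
  moreover have sq: "u / 2 * x ^ 2 - u / 2 * y ^ 2 \<ge> 1" if "0 \<le> y" "x - y \<ge> 1" for x y
  proof -
    have "1 \<le> (x - y) * (x + y)" using that mult_mono[of 1 "x - y" 1 "x + y"] by auto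
    then have "1 * 1 \<le> u / 2 * ((x - y) * (x + y))" using \<open>3 \<le> u\<close> by (intro mult_mono) auto
    then show ?thesis by (simp add: algebra_simps power2_eq_square)
  qed
  have lin: "u * x - u * y \<ge> 1" if "0 \<le> y" "x - y \<ge> 1" for x y
    using mult_mono[of 1 u 1 "x - y"] that \<open>3 \<le> u\<close> by (simp add: algebra_simps)
  have "monotone_interp sig {0..} (gt_delta 1) ?I"
    using sq lin by (intro monotone_interp_interp) (simp_all add: gt_delta_def)
  moreover have "compatible_interp rules {0..} (gt_delta 1) ?I"
  proof (intro compatible_interp_interp)
    fix x :: real
    assume "x \<in> {0..}"
    then have x: "x \<ge> 0" by simp
    \<comment> \<open>With u^2 replaced by 10 throughout, every inequality becomes linear in the
      remaining monomials, and u x \<ge> 3 x settles the rule comparing g(x) with x + x.\<close>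
    have u3: "u * (u * t) = 10 * t" for t using u2 by (simp flip: mult.assoc)
    have ux: "u * x \<ge> 3 * x" using x \<open>3 \<le> u\<close> by (intro mult_right_mono) auto
    have xu: "x * u = u * x" by simp
    have uxx: "u * x * (u * x) = 10 * (x * x)" using u3[of "x * x"] by (simp add: mult_ac)
    show "gt_delta 1 (u / 2 * (u * x + 4) ^ 2 + 0 * (u * x + 4)) (u * (u * (u / 2 * x ^ 2 + 0 * x) + 4) + 4) \<and>
      gt_delta 1 (u * (x + 1) + 4) (u * x + 4 + 1 + 1) \<and>
      gt_delta 1 (u * x + 4) (x + x) \<and>
      gt_delta 1 (x + 1) (x + 0) \<and>
      gt_delta 1 (x + 1) (0 + x) \<and>
      gt_delta 1 (u / 2 * x ^ 2 + 0 * x + (u * x + 4)) (u / 2 * (x + 1) ^ 2 + 0 * (x + 1)) \<and>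
      gt_delta 1 (u / 2 * (x + 1) ^ 2 + 0 * (x + 1) + of_nat 4 * 1) (u / 2 * x ^ 2 + 0 * x + (u * x + 4)) \<and>
      gt_delta 1 (0 + 1) (u / 2 * 0 ^ 2 + 0 * 0) \<and>
      gt_delta 1 (0 + of_nat 3 * 1) (u / 2 * (0 + 1) ^ 2 + 0 * (0 + 1)) \<and>
      gt_delta 1 (u * (u * (u * x + 4) + 4) + 4 + (of_nat 300 * x + 0) + of_nat 500 * 1)
         (of_nat 30 * (u * (u * x + 4) + 4) + 0 + (of_nat 10 * (u * x + 4) + 0)) \<and>
      gt_delta 1 (of_nat 30 * (u * (u * x + 4) + 4) + 0 + (of_nat 10 * (u * x + 4) + 0))
         (u * (u * (u * x + 4) + 4) + 4 + (of_nat 300 * x + 0))"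
      using x ux \<open>3 \<le> u\<close> \<open>u \<le> 13 / 4\<close>
      by (auto simp: gt_delta_def power2_eq_square distrib_left distrib_right u3 u2 xu uxx)
  qed
  ultimately show ?thesis
    unfolding poly_terminating_field_def by (metis zero_less_one)
qed

section \<open>No interpretation over the rationals\<close>

text \<open>Degrees multiply under composition, so deg G * deg G * deg F \<le> deg F * deg G with
  both degrees positive. It serves twice: for g below f, and for s below g.\<close>

lemma affine_of_duplicating_rule:
  fixes F G :: "'a::linordered_field poly"
  assumes "\<delta> > 0" "delta_mono \<delta> (poly F)" "delta_mono \<delta> (poly G)"
    and "\<And>x. x \<ge> 0 \<Longrightarrow> 0 \<le> poly F x" "\<And>x. x \<ge> 0 \<Longrightarrow> 0 \<le> poly G x"
    and "\<And>x. x \<ge> 0 \<Longrightarrow> poly G (poly G (poly F x)) + \<delta> \<le> poly F (poly G x)"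
  shows "degree G = 1"
proof -
  have "degree (pcompose G (pcompose G F)) \<le> degree (pcompose F G)"
  proof (intro degree_mono_of_poly_le)
    fix x :: 'a
    assume x: "x \<ge> 0"
    show "0 \<le> poly (pcompose G (pcompose G F)) x" using assms(4,5) x by (simp add: poly_pcompose)
    show "poly (pcompose G (pcompose G F)) x \<le> poly (pcompose F G) x"
      using assms(1,6) x by (simp add: poly_pcompose) (meson add_increasing2 le_add_same_cancel1 less_imp_le order_trans)
  qed
  then have "degree G * (degree G * degree F) \<le> 1 * (degree G * degree F)"
    by (simp add: degree_pcompose mult.commute)
  moreover have "degree F > 0" "degree G > 0" using assms delta_mono_degree_pos by blast+
  ultimately show ?thesis by simp
qed

text \<open>Once S is affine with slope a, comparing slopes in the rule gives a * a * u \<le> u * a,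
  hence a \<le> 1, while monotonicity gives a \<ge> 1.\<close>

lemma slope_1_of_duplicating_rule:
  fixes S :: "'a::linordered_field poly"
  assumes "\<delta> > 0" "delta_mono \<delta> (poly S)" "\<And>x. x \<ge> 0 \<Longrightarrow> 0 \<le> poly S x"
    and "u \<ge> 1" "w \<ge> 0"
    and "\<And>x. x \<ge> 0 \<Longrightarrow> poly S (poly S (u * x + w)) + \<delta> \<le> u * poly S x + w"
  obtains s where "s > 0" "\<And>x. poly S x = x + s"
proof -
  have "degree S = 1"
  proof (rule affine_of_duplicating_rule[of \<delta> "[:w, u:]"])
    show "delta_mono \<delta> (poly [:w, u:])"
      unfolding delta_mono_def
    proof (intro allI impI)
      fix x y :: 'a assume "0 \<le> y \<and> y + \<delta> \<le> x"
      then have "1 * \<delta> \<le> u * (x - y)" using assms(1,4) by (intro mult_mono) auto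
      then show "poly [:w, u:] y + \<delta> \<le> poly [:w, u:] x" by (simp add: algebra_simps)
    qed
  qed (use assms in \<open>auto simp: algebra_simps\<close>)
  then obtain a s where S: "\<And>x. poly S x = a * x + s"
    using degree_le_1_eval[of S] by auto
  have a: "a \<ge> 1"
    using assms(2) delta_mono_slope_ge_1[of \<delta> a s] assms(1) S by (simp add: delta_mono_def)
  have "(a * a * u) * x + (a * a * w + a * s + s + \<delta>) \<le> (u * a) * x + (u * s + w)" if "x \<ge> 0" for x
    using assms(6)[OF that] by (simp add: S algebra_simps)
  then have "a * a * u \<le> u * a" by (rule slope_le_of_affine_le)
  then have "(a * u) * a \<le> (a * u) * 1" by (simp add: algebra_simps)
  then have "a \<le> 1" by (rule mult_left_le_imp_le) (use a assms(4) in auto)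
  with a have a1: "a = 1" by simp
  have "s \<ge> 0" using assms(3)[of 0] S by simp
  \<comment> \<open>For s = 0 the rule at x = 0 would read w + \<delta> \<le> w.\<close>
  moreover have "s \<noteq> 0" using assms(6)[of 0] assms(1) S a1 by auto
  ultimately show ?thesis using that S a1 by auto
qed

text \<open>Monotonicity carries the linear bound on the diagonal to all arguments, so every section
  is affine and H has the form a x y + b x + c0 y + d. The diagonal rules out the mixed term, and
  the sections at z cap both slopes at 1.\<close>

lemma bivariate_sum:
  fixes H :: "'a::linordered_field \<Rightarrow> 'a \<Rightarrow> 'a"
  assumes \<delta>: "\<delta> > 0"
    and sec1: "\<And>y. \<exists>P. \<forall>x. H x y = poly P x" and sec2: "\<And>x. \<exists>P. \<forall>y. H x y = poly P y"
    and nonneg: "\<And>x y. x \<ge> 0 \<Longrightarrow> y \<ge> 0 \<Longrightarrow> H x y \<ge> 0"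
    and mono1: "\<And>y. y \<ge> 0 \<Longrightarrow> delta_mono \<delta> (\<lambda>x. H x y)"
    and mono2: "\<And>x. x \<ge> 0 \<Longrightarrow> delta_mono \<delta> (H x)"
    and diag: "\<And>x. x \<ge> 0 \<Longrightarrow> H x x \<le> u * x + w"
    and z: "z \<ge> 0" "\<And>x. x \<ge> 0 \<Longrightarrow> H x z \<le> x + c" "\<And>x. x \<ge> 0 \<Longrightarrow> H z x \<le> x + c"
  obtains h where "\<And>x y. x \<ge> 0 \<Longrightarrow> y \<ge> 0 \<Longrightarrow> H x y = x + y + h"
proof -
  \<comment> \<open>The detour through m + \<delta> is due to the gap: monotonicity only compares
    arguments at distance at least \<delta>.\<close>
  have bound: "H x y \<le> u * (m + \<delta>) + w" if "0 \<le> x" "0 \<le> y" "x \<le> m" "y \<le> m" for x y m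
  proof -
    have "H x y + \<delta> \<le> H (m + \<delta>) y"
      using mono1[of y] that unfolding delta_mono_def by simp
    moreover have "H (m + \<delta>) y + \<delta> \<le> H (m + \<delta>) (m + \<delta>)"
      using mono2[of "m + \<delta>"] that \<delta> unfolding delta_mono_def by simp
    ultimately show ?thesis using diag[of "m + \<delta>"] that \<delta> by simp
  qed
  have affine: "\<exists>a b. \<forall>x. \<phi> x = a * x + b"
    if "0 \<le> y" "\<phi> = poly P" "\<And>x. x \<ge> 0 \<Longrightarrow> 0 \<le> \<phi> x"
      "\<And>x. x \<ge> 0 \<Longrightarrow> \<phi> x \<le> u * (x + y + \<delta>) + w" for \<phi> y P
  proof -
    have "degree P \<le> degree [:u * (y + \<delta>) + w, u:]"
      using that by (intro degree_mono_of_poly_le) (auto simp: algebra_simps)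
    also have "\<dots> \<le> 1" by simp
    finally show ?thesis using degree_le_1_eval that(2) by blast
  qed
  have aff1: "\<exists>a b. \<forall>x. H x y = a * x + b" if "y \<ge> 0" for y
  proof -
    obtain P where "\<forall>x. H x y = poly P x" using sec1 by blast
    then show ?thesis using affine[of y "\<lambda>x. H x y" P] nonneg bound that
      by (metis (full_types) add.commute le_add_same_cancel1 ext)
  qed
  have aff2: "\<exists>a b. \<forall>y. H x y = a * y + b" if "x \<ge> 0" for x
  proof -
    obtain P where "\<forall>y. H x y = poly P y" using sec2 by blast
    then show ?thesis using affine[of x "H x" P] nonneg bound that
      by (metis (full_types) add.commute le_add_same_cancel1 ext)
  qed
  \<comment> \<open>Each section in x is affine, so its values at x = 0 and x = 1, themselves affine
    in y, determine H.\<close>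
  obtain c0 d where H0: "\<And>y. H 0 y = c0 * y + d" using aff2[of 0] by auto
  obtain c1 d1 where H1: "\<And>y. H 1 y = c1 * y + d1" using aff2[of 1] by auto
  define a b where "a = c1 - c0" and "b = d1 - d"
  have H: "H x y = (a * y + b) * x + (c0 * y + d)" if "y \<ge> 0" for x y
  proof -
    obtain p q where pq: "\<And>x. H x y = p * x + q" using aff1[OF \<open>y \<ge> 0\<close>] by auto
    have "q = c0 * y + d" using pq[of 0] H0[of y] by simp
    moreover have "p = a * y + b"
      using pq[of 1] pq[of 0] H0[of y] H1[of y] by (simp add: a_def b_def algebra_simps)
    ultimately show ?thesis using pq by simp
  qed
  have slope1: "a * y + b \<ge> 1" if "y \<ge> 0" for y
    using mono1[OF that] H[OF that] \<delta> by (intro delta_mono_slope_ge_1[of \<delta> _ "c0 * y + d"]) auto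
  have slope2: "a * x + c0 \<ge> 1" if "x \<ge> 0" for x
  proof (rule delta_mono_slope_ge_1[of \<delta> _ "b * x + d"])
    show "delta_mono \<delta> (\<lambda>y. (a * x + c0) * y + (b * x + d))"
      unfolding delta_mono_def
    proof (intro allI impI)
      fix v y :: 'a assume vy: "0 \<le> y \<and> y + \<delta> \<le> v"
      then have "H x y + \<delta> \<le> H x v" using mono2[OF that] by (simp add: delta_mono_def)
      moreover have "v \<ge> 0" using vy \<delta> by linarith
      ultimately show "(a * x + c0) * y + (b * x + d) + \<delta> \<le> (a * x + c0) * v + (b * x + d)"
        using vy by (simp add: H algebra_simps)
    qed
  qed (rule \<delta>)
  \<comment> \<open>The slope a y + b in the first argument stays at least 1 for arbitrarily large
    y, so a cannot be negative; the x^2 coefficient on the diagonal then gives the converse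
    bound.\<close>
  have "0 * x + 1 \<le> a * x + b" if "x \<ge> 0" for x using slope1[OF that] by simp
  then have "a \<ge> 0" by (rule slope_le_of_affine_le)
  moreover have "coeff [:d, b + c0, a:] 2 \<le> coeff [:w, u:] 2"
  proof (rule coeff_mono_of_poly_le)
    fix x :: 'a assume "x \<ge> 0"
    then show "poly [:d, b + c0, a:] x \<le> poly [:w, u:] x"
      using diag[of x] by (simp add: H algebra_simps)
  qed auto
  then have "a \<le> 0" by (simp add: numeral_2_eq_2)
  ultimately have a: "a = 0" by simp
  have "b * x + (c0 * z + d) \<le> 1 * x + c" if "x \<ge> 0" for x
    using z(2)[OF that] z(1) by (simp add: H a)
  then have "b \<le> 1" by (rule slope_le_of_affine_le)
  moreover have "c0 * x + (b * z + d) \<le> 1 * x + c" if "x \<ge> 0" for x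
    using z(3)[OF that] that by (simp add: H a algebra_simps)
  then have "c0 \<le> 1" by (rule slope_le_of_affine_le)
  ultimately have "b = 1" "c0 = 1" using slope1[of 0] slope2[of 0] by auto
  then show ?thesis using that[of d] H a by (simp add: algebra_simps)
qed

text \<open>F(x + s) - F(x) - u x is a bounded polynomial, hence a constant e. Subtracting a
  quadratic with the same difference leaves an s-periodic polynomial, hence a constant.\<close>

lemma quadratic_of_difference:
  fixes F :: "'a::linordered_field poly"
  assumes "s > 0"
    and "\<And>x. x \<ge> 0 \<Longrightarrow> poly F (x + s) \<le> poly F x + u * x + l"
    and "\<And>x. x \<ge> 0 \<Longrightarrow> poly F x + u * x + m \<le> poly F (x + s)"
  obtains b c where "\<And>x. poly F x = u / (2 * s) * x ^ 2 + b * x + c"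
proof -
  let ?D = "pcompose F [:s, 1:] - F - [:0, u:]"
  have D: "poly ?D x = poly F (x + s) - poly F x - u * x" for x
    by (simp add: poly_pcompose algebra_simps)
  obtain e where "?D = [:e:]"
    using bounded_poly_constant[of m ?D l] assms D by (smt (verit) D add_le_cancel_left diff_le_eq le_diff_eq add.commute add.left_commute)
  then have diff: "poly F (x + s) = poly F x + u * x + e" for x
    using D[of x] by (simp add: algebra_simps)
  \<comment> \<open>Solves u s / 2 + b s = e, so that u / (2 s) x^2 + b x has the difference u x +
    e.\<close>
  define b where "b = e / s - u / 2"
  let ?P = "F - [:0, b, u / (2 * s):]"
  have P: "poly ?P x = poly F x - (u / (2 * s) * x ^ 2 + b * x)" for x
    by (simp add: algebra_simps power2_eq_square)
  have "poly ?P (x + s) = poly ?P x" for x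
    unfolding P b_def using assms(1) diff[of x] by (simp add: field_simps power2_eq_square)
  then have "poly ?P x = poly ?P 0" for x
    using periodic_poly_constant[of ?P s] assms(1) by blast
  then have "poly F x = u / (2 * s) * x ^ 2 + b * x + poly ?P 0" for x
    using P[of x] by (metis add.commute diff_add_cancel)
  then show ?thesis using that by blast
qed

text \<open>At the midpoint a quadratic with leading coefficient 15 / s lies 15 s / 4 below the mean
  of its end values. These sum to at most 2 z + 4 s \<le> 6 s, less than 15 s / 2, so the midpoint
  value is negative.\<close>

lemma no_steep_quadratic:
  fixes F :: "'a::linordered_field poly"
  assumes "\<And>x. x \<ge> 0 \<Longrightarrow> 0 \<le> poly F x" "\<And>x. poly F x = 30 / (2 * s) * x ^ 2 + b * x + c"
    and "0 \<le> z" "z \<le> s" "0 < s" "poly F z \<le> z + s" "poly F (z + s) \<le> z + 3 * s"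
  shows False
proof -
  have "2 * poly F (z + s / 2) = poly F z + poly F (z + s) - 15 / 2 * s"
    unfolding assms(2) using assms(5) by (simp add: field_simps power2_eq_square)
  moreover have "0 \<le> poly F (z + s / 2)" using assms by simp
  ultimately show False using assms by linarith
qed

lemma not_poly_terminating_rat_rules: "\<not> poly_terminating_field TYPE(rat) sig rules"
proof
  assume "poly_terminating_field TYPE(rat) sig rules"
  then obtain \<delta> :: rat and I where \<delta>: "\<delta> > 0" and interp: "poly_interp sig {0..} I"
    and mono: "monotone_interp sig {0..} (gt_delta \<delta>) I"
    and compat: "compatible_interp rules {0..} (gt_delta \<delta>) I"
    unfolding poly_terminating_field_def by blast
  define z where "z = mpoly_eval (I 0) []"
  define H where "H x y = mpoly_eval (I 4) [x, y]" for x y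
  have unary: "\<exists>P. \<forall>x. mpoly_eval (I f) [x] = poly P x" for f
    using mpoly_eval_section_poly[of 0 "[0]" "I f"] by (metis length_Cons list_update_code(2) zero_less_Suc)
  obtain S where S: "\<And>x. mpoly_eval (I 1) [x] = poly S x" using unary by blast
  obtain F where F: "\<And>x. mpoly_eval (I 2) [x] = poly F x" using unary by blast
  obtain G where G: "\<And>x. mpoly_eval (I 3) [x] = poly G x" using unary by blast
  have in0: "mpoly_eval (I f) xs \<ge> 0" if "sig f = Some (length xs)" "\<forall>x\<in>set xs. x \<ge> 0" for f xs
    using interp that unfolding poly_interp_def by auto
  have nonneg: "z \<ge> 0" "\<And>x. x \<ge> 0 \<Longrightarrow> poly S x \<ge> 0" "\<And>x. x \<ge> 0 \<Longrightarrow> poly F x \<ge> 0"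
    "\<And>x. x \<ge> 0 \<Longrightarrow> poly G x \<ge> 0" "\<And>x y. x \<ge> 0 \<Longrightarrow> y \<ge> 0 \<Longrightarrow> H x y \<ge> 0"
    unfolding z_def H_def S[symmetric] F[symmetric] G[symmetric]
    by (auto intro!: in0 simp: sig_def)
  have mon: "delta_mono \<delta> (\<lambda>x. mpoly_eval (I f) (xs[i := x]))"
    if "sig f = Some (length xs)" "\<forall>x\<in>set xs. x \<ge> 0" "i < length xs" for f xs i
    unfolding delta_mono_def
  proof (intro allI impI)
    fix x y assume xy: "0 \<le> y \<and> y + \<delta> \<le> x"
    then have "x \<ge> 0" using \<delta> by linarith
    then have "set (xs[i := x]) \<subseteq> {0..}" using that(2) set_update_subset_insert[of xs i x] by auto
    \<comment> \<open>Monotonicity is applied to the list already holding the larger value x; the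
      second update at i overwrites it by y.\<close>
    then have "gt_delta \<delta> (mpoly_eval (I f) (xs[i := x])) (mpoly_eval (I f) (xs[i := x, i := y]))"
      using mono[unfolded monotone_interp_def, rule_format, OF that(1), of "xs[i := x]" i y] xy that(3)
      by (simp add: gt_delta_def)
    then show "mpoly_eval (I f) (xs[i := y]) + \<delta> \<le> mpoly_eval (I f) (xs[i := x])"
      by (simp add: gt_delta_def)
  qed
  have monS: "delta_mono \<delta> (poly S)" using mon[of 1 "[0]" 0] S by (simp add: sig_def)
  have monF: "delta_mono \<delta> (poly F)" using mon[of 2 "[0]" 0] F by (simp add: sig_def)
  have monG: "delta_mono \<delta> (poly G)" using mon[of 3 "[0]" 0] G by (simp add: sig_def)
  have mon1: "delta_mono \<delta> (\<lambda>x. H x y)" if "y \<ge> 0" for y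
    using mon[of 4 "[0, y]" 0] that by (simp add: sig_def H_def)
  have mon2: "delta_mono \<delta> (H x)" if "x \<ge> 0" for x
    using mon[of 4 "[x, 0]" 1] that by (simp add: sig_def H_def[abs_def])
  have sec1: "\<exists>P. \<forall>x. H x y = poly P x" for y
    using mpoly_eval_section_poly[of 0 "[0, y]" "I 4"] by (auto simp: H_def)
  have sec2: "\<exists>P. \<forall>y. H x y = poly P y" for x
    using mpoly_eval_section_poly[of 1 "[x, 0]" "I 4"] by (auto simp: H_def)
  have rule: "trm_eval I (\<lambda>_. x) r + \<delta> \<le> trm_eval I (\<lambda>_. x) l"
    if "(l, r) \<in> rules" "x \<ge> 0" for l r x
  proof -
    have "range (\<lambda>_::nat. x) \<subseteq> {0..}" using that(2) by auto
    then have "gt_delta \<delta> (trm_eval I (\<lambda>_. x) l) (trm_eval I (\<lambda>_. x) r)"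
      using compat that(1) unfolding compatible_interp_def by blast
    then show ?thesis by (simp add: gt_delta_def)
  qed
  then have "\<forall>(l, r)\<in>rules. trm_eval I (\<lambda>_. x) r + \<delta> \<le> trm_eval I (\<lambda>_. x) l" if "x \<ge> 0" for x
    using that by blast
  note rule = this[unfolded rules_def ball_simps prod.case]
  note ev = trm_eval.simps list.map trm_eval_funpow_succT trm_eval_timesT S F G
    z_def[symmetric] H_def[symmetric]
  have rules:
    "poly G (poly G (poly F x)) + \<delta> \<le> poly F (poly G x)"
    "poly S (poly S (poly G x)) + \<delta> \<le> poly G (poly S x)"
    "H x x + \<delta> \<le> poly G x"
    "H x z + \<delta> \<le> poly S x"
    "H z x + \<delta> \<le> poly S x"
    "poly F (poly S x) + \<delta> \<le> H (poly F x) (poly G x)"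
    "H (poly F x) (poly G x) + \<delta> \<le> (poly S ^^ 4) (poly F (poly S x))"
    "poly F z + \<delta> \<le> poly S z"
    "poly F (poly S z) + \<delta> \<le> (poly S ^^ 3) z"
    "H ((H (poly G (poly G x)) ^^ 30) z) ((H (poly G x) ^^ 10) z) + \<delta>
       \<le> (poly S ^^ 500) (H (poly G (poly G (poly G x))) ((H x ^^ 300) z))"
    "H (poly G (poly G (poly G x))) ((H x ^^ 300) z) + \<delta>
       \<le> H ((H (poly G (poly G x)) ^^ 30) z) ((H (poly G x) ^^ 10) z)"
    if "x \<ge> 0" for x
    using rule[OF that] unfolding ev by blast+
  have "degree G = 1"
    using affine_of_duplicating_rule[OF \<delta> monF monG nonneg(3,4) rules(1)] by blast
  then obtain u w where Gx: "\<And>x. poly G x = u * x + w"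
    using degree_le_1_eval[of G] by auto
  have u: "u \<ge> 1"
    using monG delta_mono_slope_ge_1[of \<delta> u w] \<delta> Gx by (simp add: delta_mono_def)
  have w: "w \<ge> 0" using nonneg(4)[of 0] Gx by simp
  obtain s where s: "s > 0" and Sx: "\<And>x. poly S x = x + s"
    using slope_1_of_duplicating_rule[OF \<delta> monS nonneg(2) u w] rules(2) unfolding Gx by blast
  have S_pow: "(poly S ^^ n) x = x + of_nat n * s" for n x
    using funpow_shift[of n s x] Sx by (metis ext)
  obtain h where Hx: "\<And>x y. x \<ge> 0 \<Longrightarrow> y \<ge> 0 \<Longrightarrow> H x y = x + y + h"
  proof (rule bivariate_sum[OF \<delta> sec1 sec2 nonneg(5) mon1 mon2])
    show "H x x \<le> u * x + w" if "x \<ge> 0" for x using rules(3)[OF that] \<delta> Gx by simp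
    show "H x z \<le> x + s" if "x \<ge> 0" for x using rules(4)[OF that] \<delta> Sx by simp
    show "H z x \<le> x + s" if "x \<ge> 0" for x using rules(5)[OF that] \<delta> Sx by simp
  qed (use nonneg in auto)
  have h: "h \<ge> 0" using nonneg(5)[of 0 0] Hx by simp
  \<comment> \<open>From h(0, z) < s(0): the left side is z + h with h \<ge> 0.\<close>
  have zs: "z \<le> s" using rules(4)[of 0] Hx[of 0 z] nonneg(1) h \<delta> by (simp add: Sx)
  have H_pow: "(H v ^^ n) z = of_nat n * v + (of_nat n * h + z)" if "v \<ge> 0" for v n
  proof (induction n)
    case (Suc n)
    have "of_nat n * v + (of_nat n * h + z) \<ge> 0" using that h nonneg(1) by simp
    then show ?case using Suc Hx that by (simp add: algebra_simps)
  qed simp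
  have G0: "u * x + w \<ge> 0" if "x \<ge> 0" for x using that u w by simp
  have L: "H (poly G (poly G (poly G x))) ((H x ^^ 300) z) =
      (u ^ 3 + 300) * x + (u * (u * w + w) + w + (300 * h + z) + h)" if "x \<ge> 0" for x
    using that G0 h nonneg(1) by (simp add: Gx H_pow Hx) (simp add: algebra_simps power3_eq_cube)
  have R: "H ((H (poly G (poly G x)) ^^ 30) z) ((H (poly G x) ^^ 10) z) =
      (30 * u ^ 2 + 10 * u) * x + (30 * (u * w + w) + (30 * h + z) + 10 * w + (10 * h + z) + h)"
    if "x \<ge> 0" for x
  proof -
    have "0 \<le> (H v ^^ n) z" if "v \<ge> 0" for v n using that h nonneg(1) by (simp add: H_pow)
    then show ?thesis using that nonneg(4)
      by (simp add: Hx, simp add: H_pow, simp add: Gx algebra_simps power2_eq_square)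
  qed
  \<comment> \<open>\<open>L\<close> and \<open>R\<close> are affine in x and bound each other up to
    constants, so their slopes are equal.\<close>
  have "30 * u ^ 2 + 10 * u \<le> u ^ 3 + 300"
  proof (rule slope_le_of_affine_le)
    show "(30 * u ^ 2 + 10 * u) * x + (30 * (u * w + w) + (30 * h + z) + 10 * w + (10 * h + z) + h)
      \<le> (u ^ 3 + 300) * x + (u * (u * w + w) + w + (300 * h + z) + h + 500 * s)" if "x \<ge> 0" for x
      using rules(10)[OF that] \<delta> unfolding L[OF that] R[OF that] S_pow by simp
  qed
  moreover have "u ^ 3 + 300 \<le> 30 * u ^ 2 + 10 * u"
  proof (rule slope_le_of_affine_le)
    show "(u ^ 3 + 300) * x + (u * (u * w + w) + w + (300 * h + z) + h)
      \<le> (30 * u ^ 2 + 10 * u) * x + (30 * (u * w + w) + (30 * h + z) + 10 * w + (10 * h + z) + h)"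
      if "x \<ge> 0" for x
      using rules(11)[OF that] \<delta> unfolding L[OF that] R[OF that] by simp
  qed
  ultimately have "(u - 30) * (u ^ 2 - 10) = 0"
    by (simp add: algebra_simps power2_eq_square power3_eq_cube)
  \<comment> \<open>The one place where rationality is used; over the reals the root sqrt 10 would
    survive.\<close>
  then have u30: "u = 30" using rat_square_neq_10[of u] by simp
  have "poly F (x + s) \<le> poly F x + 30 * x + (w + h)" if "x \<ge> 0" for x
    using rules(6)[OF that] Hx[OF nonneg(3)[OF that] nonneg(4)[OF that]] \<delta> by (simp add: Gx Sx u30)
  moreover have "poly F x + 30 * x + (w + h - 4 * s) \<le> poly F (x + s)" if "x \<ge> 0" for x
    using rules(7)[OF that] Hx[OF nonneg(3)[OF that] nonneg(4)[OF that]] \<delta>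
    unfolding S_pow by (simp add: Gx Sx u30)
  ultimately obtain b c where "\<And>x. poly F x = 30 / (2 * s) * x ^ 2 + b * x + c"
    using quadratic_of_difference[OF s] by blast
  moreover have "poly F z \<le> z + s" using rules(8)[of 0] \<delta> by (simp add: Sx)
  moreover have "poly F (z + s) \<le> z + 3 * s"
    using rules(9)[of 0] \<delta> unfolding S_pow by (simp add: Sx)
  ultimately show False
    using no_steep_quadratic[OF nonneg(3) _ nonneg(1) zs s] by blast
qed

theorem theorem5p3:
  "\<exists>(F :: nat signature) (R :: (nat, nat) rule set).
     trs F R \<and>
     poly_terminating_nat F R \<and>
     poly_terminating_field TYPE(real) F R \<and>
     \<not> poly_terminating_field TYPE(rat) F R"
  using trs_rules poly_terminating_nat_rules poly_terminating_real_rules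
    not_poly_terminating_rat_rules by blast

end
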